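(* Let $\pi_0,\pi_1,\pi_2,\pi_3\ge0$ with $\sum_i\pi_i=1$, and let $a=\pi_0+\pi_3$, $b=\pi_1+\pi_2$, $c=\pi_0-\pi_3$, $d=\pi_1-\pi_2$. Assume that $c$ and $d$ have the same sign ($cd\ge 0$), $a>b$ and $|c|\geq|d|$. Let $0<\alpha\le\frac12$ be a fixed rational number. If $$|c|>b^{\alpha}a^{1-\alpha},$$ then for all sufficiently large $N$ such that $k=\alpha N$ is an integer, $|c^N+d^N|>a^kb^{N-k}+b^ka^{N-k}$, and hence the noisy $N$-qubit cat state $\rho_N'$ is entangled across the bipartite cuts $k:(N-k)$. In particular, for the most robust partition $\alpha=\frac12$ the asymptotic condition is $|c|^2>ab$.
   Context: Setting: the single-qubit channel is $S(\rho)=\pi_0\rho+\sum_{i=1}^3\pi_i\sigma_i\rho\sigma_i$, where $\sigma_1,\sigma_2,\sigma_3$ are the Pauli matrices $\sigma_x,\sigma_y,\sigma_z$. The $N$-qubit cat (GHZ) state is $|\Psi\rangle_N=\frac{1}{\sqrt2}(|0\rangle^{\otimes N}+|1\rangle^{\otimes N})$, and $\rho_N'=S^{\otimes N}(|\Psi\rangle_N\langle\Psi|)$. A bipartite cut of type $k:(N-k)$ is a division of the $N$ qubits into a set $A$ of $k$ qubits and its complement; a state is entangled across the cut if it is not a convex combination of states of the form $\rho_A\otimes\rho_{A^c}$. *)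

theory Defs
  imports "HOL-Analysis.Analysis"
begin

text \<open>
  A system of qubits is a finite set \<open>Q\<close> of labels. Its computational basis consists of the
  bit assignments \<open>Q \<rightarrow>\<^sub>E UNIV\<close>, the two bits being the elements \<open>0\<close> and \<open>1\<close> of the
  two-element type \<open>2\<close>. Kets and operators are given by their coefficients in this basis; values
  outside the basis are irrelevant.
\<close>

type_synonym config = "nat \<Rightarrow> 2"
type_synonym ket = "config \<Rightarrow> complex"
type_synonym operator = "config \<Rightarrow> config \<Rightarrow> complex"

definition comp_basis :: "nat set \<Rightarrow> config set" where
  "comp_basis Q = (Q \<rightarrow>\<^sub>E UNIV)"

fun pauli :: "nat \<Rightarrow> complex^2^2" where
  "pauli 0 = mat 1"
| "pauli (Suc 0) = (\<chi> i j. if i = j then 0 else 1)"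
| "pauli (Suc (Suc 0)) = (\<chi> i j. if i = j then 0 else if i = 0 then - \<i> else \<i>)"
| "pauli _ = (\<chi> i j. if i \<noteq> j then 0 else if i = 0 then 1 else - 1)"

definition pauli_channel :: "(nat \<Rightarrow> real) \<Rightarrow> complex^2^2 \<Rightarrow> complex^2^2" where
  "pauli_channel p \<rho> = (\<Sum>i\<le>3. p i *\<^sub>R (pauli i ** \<rho> ** pauli i))"

text \<open>
  The tensor power of a linear map \<open>S\<close>, determined by linearity and by
  \<open>|u\<rangle>\<langle>v| \<mapsto> \<Otimes>\<^sub>q S (|u q\<rangle>\<langle>v q|)\<close>.
  Here \<open>axis i (axis j 1)\<close> is the matrix unit \<open>|i\<rangle>\<langle>j|\<close>.
\<close>

definition tensor_power_map ::
  "nat set \<Rightarrow> (complex^2^2 \<Rightarrow> complex^2^2) \<Rightarrow> operator \<Rightarrow> operator" where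
  "tensor_power_map Q S \<rho> = (\<lambda>x y. \<Sum>u\<in>comp_basis Q. \<Sum>v\<in>comp_basis Q.
     \<rho> u v * (\<Prod>q\<in>Q. S (axis (u q) (axis (v q) 1)) $ x q $ y q))"

definition tensor_power_ket :: "nat set \<Rightarrow> complex^2 \<Rightarrow> ket" where
  "tensor_power_ket Q \<phi> = (\<lambda>x. \<Prod>q\<in>Q. \<phi> $ x q)"

definition cat_ket :: "nat \<Rightarrow> ket" where
  "cat_ket N = (\<lambda>x. complex_of_real (1 / sqrt 2) *
     (tensor_power_ket {..<N} (axis 0 1) x + tensor_power_ket {..<N} (axis 1 1) x))"

definition ket_projector :: "ket \<Rightarrow> operator" where
  "ket_projector \<psi> = (\<lambda>x y. \<psi> x * cnj (\<psi> y))"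

definition noisy_cat :: "(nat \<Rightarrow> real) \<Rightarrow> nat \<Rightarrow> operator" where
  "noisy_cat p N = tensor_power_map {..<N} (pauli_channel p) (ket_projector (cat_ket N))"

text \<open>
  Hermiticity needs no separate clause: it follows from all quadratic-form values being real.
\<close>

definition density_operator :: "nat set \<Rightarrow> operator \<Rightarrow> bool" where
  "density_operator Q \<rho> \<longleftrightarrow>
     (\<forall>\<psi>. (\<Sum>x\<in>comp_basis Q. \<Sum>y\<in>comp_basis Q. cnj (\<psi> x) * \<rho> x y * \<psi> y) \<in> \<real>\<^sub>\<ge>\<^sub>0) \<and>
     (\<Sum>x\<in>comp_basis Q. \<rho> x x) = 1"

definition tensor_operator :: "nat set \<Rightarrow> nat set \<Rightarrow> operator \<Rightarrow> operator \<Rightarrow> operator" where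
  "tensor_operator A B \<rho> \<tau> =
     (\<lambda>x y. \<rho> (restrict x A) (restrict y A) * \<tau> (restrict x B) (restrict y B))"

definition separable_across :: "nat set \<Rightarrow> nat set \<Rightarrow> operator \<Rightarrow> bool" where
  "separable_across Q A \<rho> \<longleftrightarrow>
     (\<exists>(n::nat) w r s.
        (\<forall>j<n. 0 \<le> w j \<and> density_operator A (r j) \<and> density_operator (Q - A) (s j)) \<and>
        (\<Sum>j<n. w j) = (1::real) \<and>
        (\<forall>x\<in>comp_basis Q. \<forall>y\<in>comp_basis Q.
           \<rho> x y = (\<Sum>j<n. complex_of_real (w j) * tensor_operator A (Q - A) (r j) (s j) x y)))"

definition entangled_across :: "nat set \<Rightarrow> nat set \<Rightarrow> operator \<Rightarrow> bool" where
  "entangled_across Q A \<rho> \<longleftrightarrow> \<not> separable_across Q A \<rho>"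

end

theory Submission
  imports Defs
begin

text \<open>
  In the cut \<open>A | B\<close>, consider the basis states that are constant on \<open>A\<close> and on \<open>B\<close>. For a product
  \<open>r \<otimes> s\<close> the coherence between \<open>00\<close> and \<open>11\<close> is \<open>r\<^sub>0\<^sub>1 s\<^sub>0\<^sub>1\<close>; positivity of \<open>r\<close> and \<open>s\<close> bounds it by
  \<open>sqrt (r\<^sub>0\<^sub>0 s\<^sub>1\<^sub>1 \<cdot> r\<^sub>1\<^sub>1 s\<^sub>0\<^sub>0)\<close>, hence by the mean of the populations of \<open>01\<close> and \<open>10\<close>. This bound survives
  convex combinations. In the noisy cat state the coherence is \<open>(c\<^sup>N + d\<^sup>N) / 2\<close>, and both
  populations equal \<open>(a\<^sup>k b\<^sup>N\<^sup>-\<^sup>k + b\<^sup>k a\<^sup>N\<^sup>-\<^sup>k) / 2\<close>. Their sum is at most \<open>2 m\<^sup>N\<close> with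
  \<open>m = b\<^sup>\<alpha> a\<^sup>1\<^sup>-\<^sup>\<alpha>\<close>, which \<open>\<bar>c\<bar>\<^sup>N\<close> eventually beats.
\<close>

section \<open>Positivity of density operators\<close>

lemma finite_comp_basis: "finite Q \<Longrightarrow> finite (comp_basis Q)"
  by (simp add: comp_basis_def finite_PiE)

lemma restrict_in_comp_basis: "restrict f Q \<in> comp_basis Q"
  by (simp add: comp_basis_def)

text \<open>A ket supported on two basis states reduces the positivity condition to a principal 2 x
  2 block.\<close>

lemma density_operator_two_point:
  assumes Q: "finite Q" and \<rho>: "density_operator Q \<rho>"
    and xy: "x \<in> comp_basis Q" "y \<in> comp_basis Q" "x \<noteq> y"
  shows "cnj \<alpha> * \<rho> x x * \<alpha> + cnj \<alpha> * \<rho> x y * \<beta> + cnj \<beta> * \<rho> y x * \<alpha> + cnj \<beta> * \<rho> y y * \<beta> \<in> \<real>\<^sub>\<ge>\<^sub>0"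
proof -
  define \<psi> where "\<psi> = (\<lambda>u. if u = x then \<alpha> else if u = y then \<beta> else 0)"
  have sum_\<psi>: "(\<Sum>u\<in>comp_basis Q. f u) = f x + f y"
    if "\<And>u. u \<noteq> x \<Longrightarrow> u \<noteq> y \<Longrightarrow> f u = 0" for f :: "config \<Rightarrow> complex"
  proof -
    have "(\<Sum>u\<in>comp_basis Q. f u) = (\<Sum>u\<in>{x, y}. f u)"
      using finite_comp_basis[OF Q] xy that by (intro sum.mono_neutral_right) auto
    then show ?thesis
      using xy(3) by simp
  qed
  have inner: "(\<Sum>v\<in>comp_basis Q. cnj (\<psi> u) * \<rho> u v * \<psi> v)
      = cnj (\<psi> u) * \<rho> u x * \<alpha> + cnj (\<psi> u) * \<rho> u y * \<beta>" for u
    using xy(3) by (subst sum_\<psi>) (auto simp: \<psi>_def)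
  have "(\<Sum>u\<in>comp_basis Q. \<Sum>v\<in>comp_basis Q. cnj (\<psi> u) * \<rho> u v * \<psi> v) \<in> \<real>\<^sub>\<ge>\<^sub>0"
    using \<rho> by (simp add: density_operator_def)
  also have "(\<Sum>u\<in>comp_basis Q. \<Sum>v\<in>comp_basis Q. cnj (\<psi> u) * \<rho> u v * \<psi> v)
      = cnj \<alpha> * \<rho> x x * \<alpha> + cnj \<alpha> * \<rho> x y * \<beta> + (cnj \<beta> * \<rho> y x * \<alpha> + cnj \<beta> * \<rho> y y * \<beta>)"
    unfolding inner using xy(3) by (subst sum_\<psi>) (auto simp: \<psi>_def)
  finally show ?thesis
    by (simp only: add.assoc)
qed

lemma density_operator_diag_nonneg:
  assumes Q: "finite Q" and \<rho>: "density_operator Q \<rho>" and x: "x \<in> comp_basis Q"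
  shows "\<rho> x x \<in> \<real>\<^sub>\<ge>\<^sub>0"
proof -
  define \<psi> :: ket where "\<psi> = (\<lambda>u. if u = x then 1 else 0)"
  have "cnj (\<psi> u) * \<rho> u v * \<psi> v = (if v = x then if u = x then \<rho> x x else 0 else 0)" for u v
    by (simp add: \<psi>_def)
  then have "(\<Sum>u\<in>comp_basis Q. \<Sum>v\<in>comp_basis Q. cnj (\<psi> u) * \<rho> u v * \<psi> v) = \<rho> x x"
    using x finite_comp_basis[OF Q] by simp
  moreover have "(\<Sum>u\<in>comp_basis Q. \<Sum>v\<in>comp_basis Q. cnj (\<psi> u) * \<rho> u v * \<psi> v) \<in> \<real>\<^sub>\<ge>\<^sub>0"
    using \<rho> by (simp add: density_operator_def)
  ultimately show ?thesis
    by simp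
qed

text \<open>A positive 2 x 2 block has nonnegative determinant. The case \<open>x = y\<close> is
  included because two configurations may coincide when restricted to one side of a cut.\<close>

lemma density_operator_cauchy_schwarz:
  assumes Q: "finite Q" and \<rho>: "density_operator Q \<rho>"
    and x: "x \<in> comp_basis Q" and y: "y \<in> comp_basis Q"
  shows "(cmod (\<rho> x y))\<^sup>2 \<le> Re (\<rho> x x) * Re (\<rho> y y)"
proof (cases "x = y")
  case True
  have "\<rho> x x \<in> \<real>\<^sub>\<ge>\<^sub>0"
    by (rule density_operator_diag_nonneg[OF Q \<rho> x])
  then have "cmod (\<rho> x x) = Re (\<rho> x x)"
    by (auto elim: nonneg_Reals_cases)
  with True show ?thesis
    by (simp add: power2_eq_square)
next
  case False
  define r s where "r = Re (\<rho> x x)" and "s = Re (\<rho> y y)"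
  have diag: "\<rho> x x = of_real r" "\<rho> y y = of_real s" and nonneg: "0 \<le> r" "0 \<le> s"
    using density_operator_diag_nonneg[OF Q \<rho> x] density_operator_diag_nonneg[OF Q \<rho> y]
    by (auto simp: r_def s_def elim: nonneg_Reals_cases)
  note form = density_operator_two_point[OF Q \<rho> x y False, unfolded diag]
  define z where "z = \<rho> x y"
  \<comment> \<open>The test vectors (1, 1) and (1, i) force \<open>z + \<rho> y x\<close> and
    \<open>\<i> * (z - \<rho> y x)\<close> to be real.\<close>
  have herm: "\<rho> y x = cnj z"
    using form[of 1 1] form[of 1 \<i>]
    by (simp add: complex_eq_iff complex_nonneg_Reals_iff z_def)
  \<comment> \<open>The test vector \<open>(t * z, u)\<close> absorbs the phase of \<open>z\<close>,
    leaving a real quadratic form in \<open>t\<close> and \<open>u\<close>.\<close>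
  have quad: "0 \<le> t\<^sup>2 * (cmod z)\<^sup>2 * r + 2 * t * u * (cmod z)\<^sup>2 + u\<^sup>2 * s" for t u :: real
  proof -
    have "cnj (t * z) * of_real r * (t * z) + cnj (t * z) * z * of_real u
        + cnj (of_real u) * cnj z * (t * z) + cnj (of_real u) * of_real s * of_real u
      = of_real (t\<^sup>2 * (cmod z)\<^sup>2 * r + 2 * t * u * (cmod z)\<^sup>2 + u\<^sup>2 * s)"
      unfolding of_real_add of_real_mult complex_norm_square
      by (simp add: power2_eq_square algebra_simps)
    then show ?thesis
      using form[of "t * z" "of_real u"] herm by (simp add: z_def del: of_real_add of_real_mult)
  qed
  have "(cmod z)\<^sup>2 \<le> r * s"
  proof (cases "r = 0")
    case True
    have "z = 0"
    proof (rule ccontr)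
      assume "z \<noteq> 0"
      \<comment> \<open>With \<open>r = 0\<close> this choice of \<open>t\<close> gives the form the
        value \<open>- s - 2\<close>, which is negative.\<close>
      then show False
        using quad[of "- (s + 1) / (cmod z)\<^sup>2" 1] True nonneg(2) by simp
    qed
    with True show ?thesis by simp
  next
    case False
    have "0 \<le> r * (r * s - (cmod z)\<^sup>2)"
      using quad[of "- 1" r] by (simp add: power2_eq_square algebra_simps)
    then show ?thesis
      using False nonneg by (simp add: zero_le_mult_iff)
  qed
  then show ?thesis
    by (simp add: z_def r_def s_def)
qed

section \<open>Separability and coherence\<close>

lemma two_mult_le_of_squares_le:
  fixes u v :: real
  assumes "u\<^sup>2 \<le> r0 * r1" "v\<^sup>2 \<le> s0 * s1" "0 \<le> r0" "0 \<le> r1" "0 \<le> s0" "0 \<le> s1"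
  shows "2 * (u * v) \<le> r0 * s1 + r1 * s0"
proof (rule power2_le_imp_le)
  have "(2 * (u * v))\<^sup>2 = 4 * (u\<^sup>2 * v\<^sup>2)"
    by (simp add: power_mult_distrib)
  also have "\<dots> \<le> 4 * ((r0 * r1) * (s0 * s1))"
    using assms by (intro mult_left_mono mult_mono) auto
  \<comment> \<open>AM-GM for \<open>r0 * s1\<close> and \<open>r1 * s0\<close>: the gap is the
    square of their difference.\<close>
  also have "\<dots> \<le> (r0 * s1 + r1 * s0)\<^sup>2"
    using zero_le_power2[of "r0 * s1 - r1 * s0"] by (simp add: power2_eq_square algebra_simps)
  finally show "(2 * (u * v))\<^sup>2 \<le> (r0 * s1 + r1 * s0)\<^sup>2" .
qed (use assms in simp)

text \<open>\<open>f01\<close> and \<open>f10\<close> are the hybrids of \<open>f00\<close> and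
  \<open>f11\<close> along the cut, so their populations in a product state are
  \<open>r x0 x0 * s y1 y1\<close> and \<open>r x1 x1 * s y0 y0\<close>. The bound passes to
  mixtures because the populations are linear in the state and the modulus is convex.\<close>

lemma separable_across_coherence_bound:
  fixes f00 f11 f01 f10 :: config
  assumes Q: "finite Q" and A: "A \<subseteq> Q" and sep: "separable_across Q A \<rho>"
    and basis: "f00 \<in> comp_basis Q" "f11 \<in> comp_basis Q" "f01 \<in> comp_basis Q" "f10 \<in> comp_basis Q"
    and onA: "restrict f01 A = restrict f00 A" "restrict f10 A = restrict f11 A"
    and onB: "restrict f01 (Q - A) = restrict f11 (Q - A)"
             "restrict f10 (Q - A) = restrict f00 (Q - A)"
  shows "2 * cmod (\<rho> f00 f11) \<le> Re (\<rho> f01 f01) + Re (\<rho> f10 f10)"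
proof -
  define B where "B = Q - A"
  obtain n :: nat and w r s where w: "\<And>j. j < n \<Longrightarrow> 0 \<le> w j"
    and r: "\<And>j. j < n \<Longrightarrow> density_operator A (r j)"
    and s: "\<And>j. j < n \<Longrightarrow> density_operator B (s j)"
    and \<rho>: "\<And>x y. x \<in> comp_basis Q \<Longrightarrow> y \<in> comp_basis Q \<Longrightarrow>
           \<rho> x y = (\<Sum>j<n. complex_of_real (w j) * tensor_operator A B (r j) (s j) x y)"
    using sep unfolding separable_across_def B_def by blast
  define x0 x1 y0 y1 where "x0 = restrict f00 A" and "x1 = restrict f11 A"
    and "y0 = restrict f00 B" and "y1 = restrict f11 B"
  have fin: "finite A" "finite B"
    using Q A finite_subset by (auto simp: B_def)
  have basisA: "x0 \<in> comp_basis A" "x1 \<in> comp_basis A"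
    and basisB: "y0 \<in> comp_basis B" "y1 \<in> comp_basis B"
    by (simp_all add: x0_def x1_def y0_def y1_def restrict_in_comp_basis)
  have term_bound: "2 * (cmod (r j x0 x1) * cmod (s j y0 y1))
      \<le> Re (r j x0 x0 * s j y1 y1) + Re (r j x1 x1 * s j y0 y0)" if j: "j < n" for j
  proof -
    note nn = density_operator_diag_nonneg[OF fin(1) r[OF j] basisA(1)]
      density_operator_diag_nonneg[OF fin(1) r[OF j] basisA(2)]
      density_operator_diag_nonneg[OF fin(2) s[OF j] basisB(1)]
      density_operator_diag_nonneg[OF fin(2) s[OF j] basisB(2)]
    show ?thesis
      using two_mult_le_of_squares_le[OF
          density_operator_cauchy_schwarz[OF fin(1) r[OF j] basisA]
          density_operator_cauchy_schwarz[OF fin(2) s[OF j] basisB]] nn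
      by (simp add: complex_nonneg_Reals_iff)
  qed
  have "2 * cmod (\<rho> f00 f11) = 2 * cmod (\<Sum>j<n. of_real (w j) * (r j x0 x1 * s j y0 y1))"
    using basis by (simp add: \<rho> tensor_operator_def x0_def x1_def y0_def y1_def)
  also have "\<dots> \<le> 2 * (\<Sum>j<n. w j * (cmod (r j x0 x1) * cmod (s j y0 y1)))"
    using w by (intro mult_left_mono order.trans[OF norm_sum] sum_mono) (auto simp: norm_mult)
  also have "\<dots> = (\<Sum>j<n. w j * (2 * (cmod (r j x0 x1) * cmod (s j y0 y1))))"
    by (simp add: sum_distrib_left mult_ac)
  also have "\<dots> \<le> (\<Sum>j<n. w j * (Re (r j x0 x0 * s j y1 y1) + Re (r j x1 x1 * s j y0 y0)))"
    using w term_bound by (intro sum_mono mult_left_mono) auto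
  also have "\<dots> = Re (\<rho> f01 f01) + Re (\<rho> f10 f10)"
    using basis onA onB
    by (simp add: \<rho> tensor_operator_def x0_def x1_def y0_def y1_def B_def
        flip: sum.distrib distrib_left)
  finally show ?thesis .
qed

section \<open>Matrix entries of the noisy cat state\<close>

lemma pauli_channel_matrix_unit:
  "pauli_channel p (axis i (axis j 1)) $ x $ y =
     complex_of_real (if i = j then if x = y then if x = i then p 0 + p 3 else p 1 + p 2 else 0
                      else if x = y then 0 else if x = i then p 0 - p 3 else p 1 - p 2)"
proof -
  have two: "t = 0 \<or> t = 1" for t :: 2
    using exhaust_2[of t] by auto
  have unit: "axis i (axis j (1::complex)) $ m $ l = (if m = i then if l = j then 1 else 0 else 0)" for m l
    by (simp add: axis_def)
  have left: "(P ** axis i (axis j 1)) $ x $ l = (if l = j then P $ x $ i else 0)"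
    for P :: "complex^2^2" and l
    by (simp add: matrix_matrix_mult_def unit if_distrib[of "times _"] cong: if_cong)
  have "(pauli k ** axis i (axis j 1) ** pauli k) $ x $ y
      = (\<Sum>l\<in>UNIV. (pauli k ** axis i (axis j 1)) $ x $ l * pauli k $ l $ y)" for k
    by (simp add: matrix_matrix_mult_def)
  \<comment> \<open>A matrix unit between two matrices picks one entry of each. The identity and
    \<sigma>_z keep the bits while \<sigma>_x and \<sigma>_y flip them; on off-diagonal units
    \<sigma>_z and \<sigma>_y contribute a minus sign.\<close>
  then have "(pauli k ** axis i (axis j 1) ** pauli k) $ x $ y = pauli k $ x $ i * pauli k $ j $ y" for k
    by (simp only: left if_distrib[of "\<lambda>t. t * _"] mult_zero_left sum.delta finite UNIV_I if_True cong: if_cong)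
  then have sandwich: "pauli_channel p (axis i (axis j 1)) $ x $ y
      = (\<Sum>k\<le>3. p k *\<^sub>R (pauli k $ x $ i * pauli k $ j $ y))"
    by (simp add: pauli_channel_def)
  have "{..3::nat} = {0, 1, 2, 3}"
    by auto
  moreover have "pauli 2 = pauli (Suc (Suc 0))" "pauli 3 = pauli (Suc (Suc (Suc 0)))"
    by (simp_all only: numeral_2_eq_2 numeral_3_eq_3)
  ultimately have "pauli_channel p (axis i (axis j 1)) $ x $ y
      = p 0 *\<^sub>R (pauli 0 $ x $ i * pauli 0 $ j $ y)
        + p 1 *\<^sub>R (pauli (Suc 0) $ x $ i * pauli (Suc 0) $ j $ y)
        + p 2 *\<^sub>R (pauli (Suc (Suc 0)) $ x $ i * pauli (Suc (Suc 0)) $ j $ y)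
        + p 3 *\<^sub>R (pauli (Suc (Suc (Suc 0))) $ x $ i * pauli (Suc (Suc (Suc 0))) $ j $ y)"
    unfolding sandwich by (simp del: pauli.simps)
  then show ?thesis
    using two[of i] two[of j] two[of x] two[of y]
    by (elim disjE) (simp_all add: mat_def scaleR_conv_of_real)
qed

lemma tensor_power_ket_axis:
  assumes "u \<in> comp_basis Q" "finite Q"
  shows "tensor_power_ket Q (axis i 1) u = (if u = restrict (\<lambda>_. i) Q then 1 else 0)"
proof (cases "u = restrict (\<lambda>_. i) Q")
  case True
  then show ?thesis
    by (simp add: tensor_power_ket_def axis_def)
next
  case False
  then obtain q where "q \<in> Q" "u q \<noteq> i"
    using assms(1) by (metis PiE_restrict comp_basis_def restrict_ext)
  then have "tensor_power_ket Q (axis i 1) u = 0"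
    using assms(2) by (auto simp: tensor_power_ket_def axis_def intro!: prod_zero)
  with False show ?thesis by simp
qed

text \<open>The cat ket is supported on the two constant configurations. \<open>F\<close> is
  arbitrary, so the lemma applies to the ket sum and to the bra sum.\<close>

lemma sum_cat_ket:
  "(\<Sum>u\<in>comp_basis {..<N}. cat_ket N u * F u)
     = (F (restrict (\<lambda>_. 0) {..<N}) + F (restrict (\<lambda>_. 1) {..<N})) / sqrt 2"
proof -
  have "cat_ket N u * F u = (if u = restrict (\<lambda>_. 0) {..<N} then F u / sqrt 2 else 0)
      + (if u = restrict (\<lambda>_. 1) {..<N} then F u / sqrt 2 else 0)"
    if "u \<in> comp_basis {..<N}" for u
    using that by (simp add: cat_ket_def tensor_power_ket_axis algebra_simps)
  then show ?thesis
    by (simp add: sum.distrib finite_comp_basis restrict_in_comp_basis add_divide_distrib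
        del: restrict_apply)
qed

lemma noisy_cat_entry:
  defines "G p N x y i j \<equiv> \<Prod>q<N. pauli_channel p (axis i (axis j 1)) $ x q $ y q"
  shows "noisy_cat p N x y = (G p N x y 0 0 + G p N x y 0 1 + G p N x y 1 0 + G p N x y 1 1) / 2"
proof -
  define H where "H u v = (\<Prod>q<N. pauli_channel p (axis (u q) (axis (v q) 1)) $ x q $ y q)"
    for u v :: config
  define z e :: config where "z = restrict (\<lambda>_. 0) {..<N}" and "e = restrict (\<lambda>_. 1) {..<N}"
  \<comment> \<open>The amplitudes are real, so the bra sum has the same shape as the ket
    sum.\<close>
  have cnj_cat: "cnj (cat_ket N v) = cat_ket N v" for v
    by (simp add: cat_ket_def tensor_power_ket_def axis_def if_distrib cong: if_cong)
  have "noisy_cat p N x y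
      = (\<Sum>u\<in>comp_basis {..<N}. cat_ket N u * (\<Sum>v\<in>comp_basis {..<N}. cat_ket N v * H u v))"
    by (simp add: noisy_cat_def tensor_power_map_def ket_projector_def cnj_cat H_def
        sum_distrib_left mult.assoc)
  also have "\<dots> = (H z z + H z e + H e z + H e e) / (complex_of_real (sqrt 2) * sqrt 2)"
    by (simp add: sum_cat_ket z_def e_def add_divide_distrib del: restrict_apply)
  also have "complex_of_real (sqrt 2) * sqrt 2 = 2"
    by (simp flip: of_real_mult)
  finally show ?thesis
    by (simp add: H_def G_def z_def e_def)
qed

text \<open>Between all zeros and all ones, each qubit contributes \<open>p 0 - p 3\<close> from
  |0><1| and \<open>p 1 - p 2\<close> from |1><0|. Diagonal units contribute a factor 0, and
  \<open>0 < N\<close> ensures that such a factor occurs.\<close>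

lemma noisy_cat_coherence:
  assumes "0 < N"
  shows "noisy_cat p N (restrict (\<lambda>_. 0) {..<N}) (restrict (\<lambda>_. 1) {..<N})
    = complex_of_real (((p 0 - p 3) ^ N + (p 1 - p 2) ^ N) / 2)"
  using assms by (simp add: noisy_cat_entry pauli_channel_matrix_unit)

text \<open>The unit |l><l| gives a factor \<open>p 0 + p 3\<close> at each qubit whose bit is l and
  \<open>p 1 + p 2\<close> at the others. Summing over both l makes the value the same for the two
  hybrids.\<close>

lemma noisy_cat_population:
  assumes "0 < N" and A: "A \<subseteq> {..<N}" and i: "i \<noteq> j"
    and x: "x = restrict (\<lambda>q. if q \<in> A then i else j) {..<N}"
  shows "noisy_cat p N x x = complex_of_real
    (((p 0 + p 3) ^ card A * (p 1 + p 2) ^ (N - card A)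
      + (p 1 + p 2) ^ card A * (p 0 + p 3) ^ (N - card A)) / 2)"
proof -
  have split: "(\<Prod>q<N. if q \<in> A then s else t) = s ^ card A * t ^ (N - card A)" for s t :: complex
    using A by (simp add: prod.If_cases Int_absorb1 Diff_eq[symmetric] card_Diff_subset
        finite_subset[OF A])
  have ij: "i = 0 \<and> j = 1 \<or> i = 1 \<and> j = 0"
    using exhaust_2[of i] exhaust_2[of j] i by auto
  have "(\<Prod>q<N. pauli_channel p (axis l (axis l 1)) $ x q $ x q)
     = (\<Prod>q<N. if q \<in> A then complex_of_real (if i = l then p 0 + p 3 else p 1 + p 2)
               else complex_of_real (if j = l then p 0 + p 3 else p 1 + p 2))" for l
    by (intro prod.cong refl) (auto simp: x pauli_channel_matrix_unit)
  then have diag: "(\<Prod>q<N. pauli_channel p (axis l (axis l 1)) $ x q $ x q)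
     = of_real (if i = l then p 0 + p 3 else p 1 + p 2) ^ card A
       * of_real (if j = l then p 0 + p 3 else p 1 + p 2) ^ (N - card A)" for l
    by (simp only: split)
  show ?thesis
    unfolding noisy_cat_entry diag using ij assms(1)
    by (auto simp: pauli_channel_matrix_unit)
qed

text \<open>Twice the coherence is the left side of the assumed inequality; the two equal
  populations add up to the right side, against the separability bound.\<close>

lemma noisy_cat_entangled:
  assumes N: "0 < N" and A: "A \<subseteq> {..<N}"
    and "\<bar>(p 0 - p 3) ^ N + (p 1 - p 2) ^ N\<bar> >
      (p 0 + p 3) ^ card A * (p 1 + p 2) ^ (N - card A)
      + (p 1 + p 2) ^ card A * (p 0 + p 3) ^ (N - card A)"
  shows "entangled_across {..<N} A (noisy_cat p N)"
proof (rule ccontr)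
  assume "\<not> ?thesis"
  then have sep: "separable_across {..<N} A (noisy_cat p N)"
    by (simp add: entangled_across_def)
  define f01 f10 :: config where "f01 = restrict (\<lambda>q. if q \<in> A then 0 else 1) {..<N}"
    and "f10 = restrict (\<lambda>q. if q \<in> A then 1 else 0) {..<N}"
  have "2 * cmod (noisy_cat p N (restrict (\<lambda>_. 0) {..<N}) (restrict (\<lambda>_. 1) {..<N}))
      \<le> Re (noisy_cat p N f01 f01) + Re (noisy_cat p N f10 f10)"
    by (rule separable_across_coherence_bound[OF _ A sep])
       (use A in \<open>auto simp: f01_def f10_def comp_basis_def fun_eq_iff\<close>)
  then show False
    using assms(3) by (simp add: noisy_cat_coherence[OF N] noisy_cat_population[OF N A _ f01_def]
        noisy_cat_population[OF N A _ f10_def] del: of_real_add of_real_mult of_real_power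
        of_real_diff of_real_divide)
qed

section \<open>Asymptotic comparison\<close>

lemma abs_power_add_same_sign:
  fixes c d :: real
  assumes "0 \<le> c * d"
  shows "\<bar>c ^ N + d ^ N\<bar> = \<bar>c\<bar> ^ N + \<bar>d\<bar> ^ N"
proof -
  have "0 \<le> c ^ N * d ^ N"
    using assms by (simp flip: power_mult_distrib)
  then have "\<bar>c ^ N + d ^ N\<bar> = \<bar>c ^ N\<bar> + \<bar>d ^ N\<bar>"
    by (auto simp: zero_le_mult_iff)
  then show ?thesis
    by (simp add: power_abs)
qed

lemma eventually_mult_power_less_power:
  fixes m x C :: real
  assumes "0 \<le> m" "m < x"
  shows "\<forall>\<^sub>F N in sequentially. C * m ^ N < x ^ N"
proof -
  have "(\<lambda>N. C * (m / x) ^ N) \<longlonglongrightarrow> C * 0"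
    using assms by (intro tendsto_mult tendsto_const LIMSEQ_power_zero) auto
  then have "\<forall>\<^sub>F N in sequentially. C * (m / x) ^ N < 1"
    by (intro order_tendstoD(2)) auto
  then show ?thesis
    by eventually_elim (use assms in \<open>simp add: power_divide field_simps\<close>)
qed

lemma powr_mean_power:
  fixes a b \<alpha> :: real
  assumes "0 < a" "0 \<le> b" and k: "real k = \<alpha> * real N" "0 < k" "k \<le> N"
  shows "(b powr \<alpha> * a powr (1 - \<alpha>)) ^ N = b ^ k * a ^ (N - k)"
proof -
  have "(b powr \<alpha>) ^ N = b ^ k"
  proof (cases "b = 0")
    \<comment> \<open>\<open>0 powr \<alpha>\<close> is 0, and \<open>0 < k \<le> N\<close> makes
      both powers vanish.\<close>
    case True
    with k show ?thesis by (simp add: power_0_left)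
  next
    case False
    with assms show ?thesis
      by (metis less_eq_real_def powr_powr powr_realpow powr_gt_zero)
  qed
  moreover have "(a powr (1 - \<alpha>)) ^ N = a ^ (N - k)"
  proof -
    have "(a powr (1 - \<alpha>)) ^ N = a powr ((1 - \<alpha>) * real N)"
      using assms(1) by (metis powr_powr powr_realpow powr_gt_zero)
    also have "(1 - \<alpha>) * real N = real (N - k)"
      using k by (simp add: of_nat_diff algebra_simps)
    finally show ?thesis
      using assms(1) by (simp add: powr_realpow)
  qed
  ultimately show ?thesis
    by (simp add: power_mult_distrib)
qed

lemma power_mult_power_swap_le:
  fixes a b :: real
  assumes "0 \<le> b" "b \<le> a" "k \<le> N - k"
  shows "a ^ k * b ^ (N - k) \<le> b ^ k * a ^ (N - k)"
proof -
  have N: "N - k = k + (N - k - k)"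
    using assms(3) by simp
  \<comment> \<open>The common factor \<open>(a * b) ^ k\<close> leaves a comparison of the powers
    with exponent \<open>N - 2 * k\<close>.\<close>
  have "(a ^ k * b ^ k) * b ^ (N - k - k) \<le> (a ^ k * b ^ k) * a ^ (N - k - k)"
    using assms by (intro mult_left_mono power_mono) auto
  then show ?thesis
    by (subst (1 2) N) (simp add: power_add mult_ac)
qed

text \<open>Since \<open>b < a\<close>, moving exponent from \<open>b\<close> to \<open>a\<close>
  increases the weighted geometric mean. Hence the balanced cut has the weakest threshold.\<close>

lemma powr_mean_half_le:
  fixes a b \<alpha> :: real
  assumes "0 \<le> b" "b < a" "\<alpha> \<le> 1 / 2"
  shows "b powr (1 / 2) * a powr (1 - 1 / 2) \<le> b powr \<alpha> * a powr (1 - \<alpha>)"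
proof -
  have "b powr (1 / 2) * a powr (1 / 2) = b powr \<alpha> * b powr (1 / 2 - \<alpha>) * a powr (1 / 2)"
    by (simp flip: powr_add)
  also have "\<dots> \<le> b powr \<alpha> * a powr (1 / 2 - \<alpha>) * a powr (1 / 2)"
    using assms by (intro mult_right_mono mult_left_mono powr_mono2) auto
  also have "\<dots> = b powr \<alpha> * a powr (1 - \<alpha>)"
    by (simp add: mult.assoc flip: powr_add)
  finally show ?thesis
    by simp
qed

lemma eventually_coherence_exceeds_populations:
  fixes a b c d \<alpha> :: real
  assumes "0 \<le> b" "b < a" "0 \<le> c * d" "0 < \<alpha>" "\<alpha> \<le> 1 / 2"
    and "b powr \<alpha> * a powr (1 - \<alpha>) < \<bar>c\<bar>"
  shows "\<forall>\<^sub>F N in sequentially. \<forall>k::nat. real k = \<alpha> * real N \<longrightarrow>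
    a ^ k * b ^ (N - k) + b ^ k * a ^ (N - k) < \<bar>c ^ N + d ^ N\<bar>"
proof -
  have "\<forall>\<^sub>F N in sequentially. 2 * (b powr \<alpha> * a powr (1 - \<alpha>)) ^ N < \<bar>c\<bar> ^ N"
    using assms by (intro eventually_mult_power_less_power) auto
  then show ?thesis
    using eventually_gt_at_top[of 0]
  proof eventually_elim
    case (elim N)
    show ?case
    proof (intro allI impI)
      fix k :: nat
      assume k: "real k = \<alpha> * real N"
      then have "0 < real k" "real k \<le> 1 / 2 * real N"
        using assms elim(2) by (simp, metis mult_right_mono of_nat_0_le_iff)
      then have k': "0 < k" "k \<le> N" "k \<le> N - k"
        by linarith+
      \<comment> \<open>As \<open>2 * k \<le> N\<close>, the second summand dominates; the resulting
        factor 2 is absorbed by the strict gap between the geometric bases.\<close>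
      have "a ^ k * b ^ (N - k) + b ^ k * a ^ (N - k) \<le> 2 * (b ^ k * a ^ (N - k))"
        using power_mult_power_swap_le[OF assms(1) _ k'(3), of a] assms by simp
      also have "\<dots> = 2 * (b powr \<alpha> * a powr (1 - \<alpha>)) ^ N"
        using powr_mean_power[OF _ assms(1) k k'(1,2), of a] assms by simp
      also have "\<dots> < \<bar>c\<bar> ^ N"
        by (rule elim(1))
      \<comment> \<open>With equal signs nothing cancels, so the \<open>d\<close> term only
        helps.\<close>
      also have "\<dots> \<le> \<bar>c ^ N + d ^ N\<bar>"
        using abs_power_add_same_sign[OF assms(3)] by simp
      finally show "a ^ k * b ^ (N - k) + b ^ k * a ^ (N - k) < \<bar>c ^ N + d ^ N\<bar>" .
    qed
  qed
qed

theorem mainTheorem8: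
  fixes p :: "nat \<Rightarrow> real" and a b c d :: real
  assumes p_nonneg: "\<forall>i\<le>3. 0 \<le> p i"
    and p_sum: "(\<Sum>i\<le>3. p i) = 1"
    and a_eq: "a = p 0 + p 3" and b_eq: "b = p 1 + p 2"
    and c_eq: "c = p 0 - p 3" and d_eq: "d = p 1 - p 2"
    and same_sign: "c * d \<ge> 0" and ab: "a > b" and cd: "\<bar>c\<bar> \<ge> \<bar>d\<bar>"
  shows "(\<forall>\<alpha>::real. \<alpha> \<in> \<rat> \<and> 0 < \<alpha> \<and> \<alpha> \<le> 1 / 2 \<and> \<bar>c\<bar> > b powr \<alpha> * a powr (1 - \<alpha>) \<longrightarrow>
           (\<forall>\<^sub>F N in sequentially. \<forall>k::nat. real k = \<alpha> * real N \<longrightarrow>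
              \<bar>c ^ N + d ^ N\<bar> > a ^ k * b ^ (N - k) + b ^ k * a ^ (N - k) \<and>
              (\<forall>A. A \<subseteq> {..<N} \<and> card A = k \<longrightarrow> entangled_across {..<N} A (noisy_cat p N))))
       \<and> (\<forall>\<alpha>::real. 0 < \<alpha> \<and> \<alpha> \<le> 1 / 2 \<longrightarrow>
           b powr (1 / 2) * a powr (1 - 1 / 2) \<le> b powr \<alpha> * a powr (1 - \<alpha>))
       \<and> (\<bar>c\<bar> > b powr (1 / 2) * a powr (1 - 1 / 2) \<longleftrightarrow> \<bar>c\<bar>\<^sup>2 > a * b)
       \<and> (\<bar>c\<bar>\<^sup>2 > a * b \<longrightarrow>
           (\<forall>\<^sub>F N in sequentially. \<forall>k::nat. real k = 1 / 2 * real N \<longrightarrow>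
              \<bar>c ^ N + d ^ N\<bar> > a ^ k * b ^ (N - k) + b ^ k * a ^ (N - k) \<and>
              (\<forall>A. A \<subseteq> {..<N} \<and> card A = k \<longrightarrow> entangled_across {..<N} A (noisy_cat p N))))"
proof -
  have b: "0 \<le> b"
    using p_nonneg b_eq by simp
  have main: "\<forall>\<^sub>F N in sequentially. \<forall>k::nat. real k = \<alpha> * real N \<longrightarrow>
      \<bar>c ^ N + d ^ N\<bar> > a ^ k * b ^ (N - k) + b ^ k * a ^ (N - k) \<and>
      (\<forall>A. A \<subseteq> {..<N} \<and> card A = k \<longrightarrow> entangled_across {..<N} A (noisy_cat p N))"
    if \<alpha>: "0 < \<alpha>" "\<alpha> \<le> 1 / 2" "\<bar>c\<bar> > b powr \<alpha> * a powr (1 - \<alpha>)" for \<alpha> :: real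
    using eventually_coherence_exceeds_populations[OF b ab same_sign \<alpha>]
      eventually_gt_at_top[of 0]
  proof eventually_elim
    case (elim N)
    then show ?case
      using noisy_cat_entangled[OF elim(2), of _ p] by (auto simp: a_eq b_eq c_eq d_eq)
  qed
  \<comment> \<open>At \<alpha> = 1/2 the mean is \<open>sqrt (a * b)\<close>, and squaring two
    nonnegative numbers preserves their order.\<close>
  have half: "\<bar>c\<bar> > b powr (1 / 2) * a powr (1 - 1 / 2) \<longleftrightarrow> \<bar>c\<bar>\<^sup>2 > a * b"
  proof -
    have "b powr (1 / 2) * a powr (1 - 1 / 2) = sqrt (a * b)"
      using b ab by (simp add: powr_half_sqrt real_sqrt_mult)
    moreover have "sqrt (a * b) < \<bar>c\<bar> \<longleftrightarrow> a * b < \<bar>c\<bar>\<^sup>2"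
      by (metis abs_ge_zero real_sqrt_less_iff real_sqrt_unique)
    ultimately show ?thesis by simp
  qed
  show ?thesis
    using main main[of "1 / 2"] powr_mean_half_le[OF b ab] half by auto
qed

end
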